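(* For $n\ge1$, we have $\mathbf{I}_n(001,100)=\mathbf{I}_n(\ge,\le,\ne)$. Consequently, the cardinality of $\mathbf{I}_n(001,100)$ is $F_{n+2}-1$, where $F_m$ is the $m$-th Fibonacci number.
   Context: An inversion sequence of length $n$ is an integer sequence $e=(e_1,\dots,e_n)$ with $0\le e_i\le i-1$ for all $1\le i\le n$. A word $w_1\cdots w_n$ avoids a pattern $P=p_1\cdots p_k$ if there are no $i_1<\cdots<i_k$ such that $w_{i_1}\cdots w_{i_k}$ is order isomorphic to $P$ (equal letters of $P$ corresponding to equal entries). $\mathbf{I}_n(001,100)$ is the set of inversion sequences of length $n$ avoiding both $001$ and $100$. $\mathbf{I}_n(\ge,\le,\ne)$ is the set of inversion sequences $e$ of length $n$ with no $i<j<k$ such that $e_i\ge e_j$, $e_j\le e_k$ and $e_i\ne e_k$. Fibonacci numbers: $F_0=0$, $F_1=1$, $F_m=F_{m-1}+F_{m-2}$ for $m\ge2$. *)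

theory Defs
  imports "HOL-Number_Theory.Fib"
begin

text \<open>
  A sequence \<open>(e\<^sub>1, \<dots>, e\<^sub>n)\<close> is a list indexed from 0, so \<open>e\<^sub>i\<close> is \<open>e ! (i - 1)\<close> and the bound
  \<open>0 \<le> e\<^sub>i \<le> i - 1\<close> becomes \<open>e ! i \<le> i\<close> for \<open>i < n\<close>.
\<close>

definition inversion_sequences :: "nat \<Rightarrow> nat list set" where
  "inversion_sequences n = {e. length e = n \<and> (\<forall>i<n. e ! i \<le> i)}"

definition order_isomorphic :: "nat list \<Rightarrow> nat list \<Rightarrow> bool" where
  "order_isomorphic u v \<longleftrightarrow> length u = length v \<and>
     (\<forall>a<length u. \<forall>b<length u.
        (u ! a < u ! b \<longleftrightarrow> v ! a < v ! b) \<and> (u ! a = u ! b \<longleftrightarrow> v ! a = v ! b))"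

text \<open>The list \<open>js\<close> holds the positions \<open>i\<^sub>1 < \<dots> < i\<^sub>k\<close> of an occurrence of \<open>p\<close>.\<close>

definition contains_pattern :: "nat list \<Rightarrow> nat list \<Rightarrow> bool" where
  "contains_pattern w p \<longleftrightarrow>
     (\<exists>js. sorted_wrt (<) js \<and> set js \<subseteq> {..<length w} \<and>
           order_isomorphic (map (\<lambda>j. w ! j) js) p)"

definition avoids_pattern :: "nat list \<Rightarrow> nat list \<Rightarrow> bool" where
  "avoids_pattern w p \<longleftrightarrow> \<not> contains_pattern w p"

definition inv_seqs_avoiding :: "nat \<Rightarrow> nat list set \<Rightarrow> nat list set" where
  "inv_seqs_avoiding n P = {e \<in> inversion_sequences n. \<forall>p\<in>P. avoids_pattern e p}"

text \<open>
  \<open>I\<^sub>n(r\<^sub>1, r\<^sub>2, r\<^sub>3)\<close>: the relations are applied to \<open>(e\<^sub>i, e\<^sub>j)\<close>, \<open>(e\<^sub>j, e\<^sub>k)\<close> and \<open>(e\<^sub>i, e\<^sub>k)\<close>, in this order.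
\<close>

definition inv_seqs_avoiding_rels ::
  "nat \<Rightarrow> (nat \<Rightarrow> nat \<Rightarrow> bool) \<Rightarrow> (nat \<Rightarrow> nat \<Rightarrow> bool) \<Rightarrow> (nat \<Rightarrow> nat \<Rightarrow> bool) \<Rightarrow> nat list set" where
  "inv_seqs_avoiding_rels n r1 r2 r3 =
     {e \<in> inversion_sequences n.
        \<not> (\<exists>i j k. i < j \<and> j < k \<and> k < n \<and>
             r1 (e ! i) (e ! j) \<and> r2 (e ! j) (e ! k) \<and> r3 (e ! i) (e ! k))}"

end

theory Submission
  imports Defs
begin

text \<open>
  The triples forbidden by \<open>(\<ge>, \<le>, \<noteq>)\<close> are the occurrences of 001, the occurrences of 100, and the
  strict valleys \<open>e\<^sub>i > e\<^sub>j < e\<^sub>k\<close> with \<open>e\<^sub>i \<noteq> e\<^sub>k\<close>. The two sets agree because an inversion sequence that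
  avoids 001 has no strict valley: every entry of it that lies below the largest value its position
  permits is a repetition of an earlier entry (lemma \<open>small_entry_repeats\<close>), so the bottom of a valley
  would be the second letter of an occurrence of 001 ending at \<open>e\<^sub>k\<close>.

  The count rests on where the zeros of such a sequence can be. A sequence starts with 0. If the second
  entry is 0 too, every entry is 0. Otherwise the second entry is 1, and a later zero that is not the
  last entry would have to be followed by an entry equal to both 0 and 1; so, apart from the first
  entry, only the last can be 0. Deleting these zeros and lowering the remaining entries by one gives
  an arbitrary sequence that is shorter by one or by two
  (lemma \<open>ge_le_ne_avoiders_Suc_Suc\<close>). Hence the numbers \<open>a\<^sub>n\<close> satisfy
  \<open>a\<^sub>n = 1 + a\<^sub>n\<^sub>-\<^sub>1 + a\<^sub>n\<^sub>-\<^sub>2\<close> for \<open>n \<ge> 3\<close>, which is the recurrence of \<open>F\<^sub>n\<^sub>+\<^sub>2 - 1\<close>.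
\<close>

section \<open>Patterns of length three\<close>

lemma contains_pattern_length_3:
  "contains_pattern w [a, b, c] \<longleftrightarrow>
     (\<exists>i j k. i < j \<and> j < k \<and> k < length w \<and>
        order_isomorphic [w ! i, w ! j, w ! k] [a, b, c])"
proof
  assume "contains_pattern w [a, b, c]"
  then obtain js where js: "sorted_wrt (<) js" "set js \<subseteq> {..<length w}"
    "order_isomorphic (map (\<lambda>j. w ! j) js) [a, b, c]"
    unfolding contains_pattern_def by blast
  then have "length js = 3"
    by (simp add: order_isomorphic_def)
  then obtain i j k where "js = [i, j, k]"
    by (auto simp: numeral_3_eq_3 length_Suc_conv)
  with js show "\<exists>i j k. i < j \<and> j < k \<and> k < length w \<and>
      order_isomorphic [w ! i, w ! j, w ! k] [a, b, c]"
    by auto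
next
  assume "\<exists>i j k. i < j \<and> j < k \<and> k < length w \<and>
      order_isomorphic [w ! i, w ! j, w ! k] [a, b, c]"
  then obtain i j k where "i < j" "j < k" "k < length w"
    "order_isomorphic [w ! i, w ! j, w ! k] [a, b, c]" by blast
  then show "contains_pattern w [a, b, c]"
    unfolding contains_pattern_def by (intro exI[of _ "[i, j, k]"]) auto
qed

lemma order_isomorphic_001: "order_isomorphic [x, y, z] [0, 0, 1] \<longleftrightarrow> x = y \<and> y < z"
  by (auto simp: order_isomorphic_def All_less_Suc numeral_3_eq_3)

lemma order_isomorphic_100: "order_isomorphic [x, y, z] [1, 0, 0] \<longleftrightarrow> y < x \<and> y = z"
  by (auto simp: order_isomorphic_def All_less_Suc numeral_3_eq_3)

lemma avoids_001_iff:
  "avoids_pattern w [0, 0, 1] \<longleftrightarrow>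
     \<not> (\<exists>i j k. i < j \<and> j < k \<and> k < length w \<and> w ! i = w ! j \<and> w ! j < w ! k)"
  unfolding avoids_pattern_def contains_pattern_length_3 order_isomorphic_001 by blast

lemma avoids_100_iff:
  "avoids_pattern w [1, 0, 0] \<longleftrightarrow>
     \<not> (\<exists>i j k. i < j \<and> j < k \<and> k < length w \<and> w ! j < w ! i \<and> w ! j = w ! k)"
  unfolding avoids_pattern_def contains_pattern_length_3 order_isomorphic_100 by blast

section \<open>Equality of the two sets\<close>

text \<open>
  The earlier occurrence of the value \<open>v = e ! j\<close> is at position \<open>v\<close> itself. If \<open>e ! v\<close> were smaller
  than \<open>v\<close>, it would by induction be a repetition of an earlier entry, and these two equal entries
  followed by the larger \<open>e ! j\<close> would form 001.
\<close>

lemma small_entry_repeats: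
  assumes inv: "e \<in> inversion_sequences n" and av: "avoids_pattern e [0, 0, 1]"
  shows "j < n \<Longrightarrow> e ! j < j \<Longrightarrow> \<exists>i<j. e ! i = e ! j"
proof (induction j rule: less_induct)
  case (less j)
  let ?v = "e ! j"
  have len: "length e = n" and bound: "\<And>i. i < n \<Longrightarrow> e ! i \<le> i"
    using inv by (auto simp: inversion_sequences_def)
  have "e ! ?v = ?v"
  proof (rule ccontr)
    assume "e ! ?v \<noteq> ?v"
    with bound[of ?v] less.prems have lt: "e ! ?v < ?v" by simp
    with less obtain i where "i < ?v" "e ! i = e ! ?v"
      by (meson order.strict_trans)
    with lt less.prems len show False
      using av unfolding avoids_001_iff by blast
  qed
  with less.prems show ?case by blast
qed

lemma inv_seqs_avoiding_001_100_eq: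
  "inv_seqs_avoiding n {[0, 0, 1], [1, 0, 0]} = inv_seqs_avoiding_rels n (\<ge>) (\<le>) (\<noteq>)"
proof (intro equalityI subsetI)
  fix e assume "e \<in> inv_seqs_avoiding n {[0, 0, 1], [1, 0, 0]}"
  then have inv: "e \<in> inversion_sequences n"
    and av001: "avoids_pattern e [0, 0, 1]" and av100: "avoids_pattern e [1, 0, 0]"
    by (auto simp: inv_seqs_avoiding_def)
  have len: "length e = n" and bound: "\<And>i. i < n \<Longrightarrow> e ! i \<le> i"
    using inv by (auto simp: inversion_sequences_def)
  have False if ijk: "i < j" "j < k" "k < n" "e ! i \<ge> e ! j" "e ! j \<le> e ! k" "e ! i \<noteq> e ! k"
    for i j k
  proof -
    have "\<exists>h<j. e ! h = e ! j"
    proof (cases "e ! i = e ! j")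
      case True
      with ijk show ?thesis by blast
    next
      case False
      have "e ! i \<le> i" using bound ijk by simp
      with False ijk have "e ! j < j" by linarith
      with ijk show ?thesis using small_entry_repeats[OF inv av001] by simp
    qed
    then obtain h where "h < j" "e ! h = e ! j" by blast
    then have "\<not> e ! j < e ! k"
      using av001 ijk len unfolding avoids_001_iff by blast
    with ijk have "e ! k = e ! j" "e ! j < e ! i" by simp_all
    with ijk len show False
      using av100 unfolding avoids_100_iff by metis
  qed
  with inv show "e \<in> inv_seqs_avoiding_rels n (\<ge>) (\<le>) (\<noteq>)"
    by (auto simp: inv_seqs_avoiding_rels_def)
next
  fix e assume "e \<in> inv_seqs_avoiding_rels n (\<ge>) (\<le>) (\<noteq>)"
  then have inv: "e \<in> inversion_sequences n"
    and av: "\<And>i j k. i < j \<Longrightarrow> j < k \<Longrightarrow> k < n \<Longrightarrow> e ! j \<le> e ! i \<Longrightarrow> e ! j \<le> e ! k \<Longrightarrow> e ! i = e ! k"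
    by (auto simp: inv_seqs_avoiding_rels_def)
  have len: "length e = n"
    using inv by (simp add: inversion_sequences_def)
  have "avoids_pattern e [0, 0, 1]"
    unfolding avoids_001_iff len using av by (metis less_imp_le order_refl less_irrefl)
  moreover have "avoids_pattern e [1, 0, 0]"
    unfolding avoids_100_iff len using av by (metis less_imp_le order_refl less_irrefl)
  ultimately show "e \<in> inv_seqs_avoiding n {[0, 0, 1], [1, 0, 0]}"
    using inv by (simp add: inv_seqs_avoiding_def)
qed

section \<open>Counting\<close>

abbreviation ge_le_ne_avoiders :: "nat \<Rightarrow> nat list set" where
  "ge_le_ne_avoiders n \<equiv> inv_seqs_avoiding_rels n (\<ge>) (\<le>) (\<noteq>)"

lemma ge_le_ne_avoiders_iff:
  "e \<in> ge_le_ne_avoiders n \<longleftrightarrow> length e = n \<and> (\<forall>i<n. e ! i \<le> i) \<and>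
     (\<forall>i j k. i < j \<longrightarrow> j < k \<longrightarrow> k < n \<longrightarrow> e ! j \<le> e ! i \<longrightarrow> e ! j \<le> e ! k \<longrightarrow> e ! i = e ! k)"
  by (auto simp: inv_seqs_avoiding_rels_def inversion_sequences_def)

lemma ge_le_ne_avoidersD:
  assumes "e \<in> ge_le_ne_avoiders n"
  shows "length e = n" and "i < n \<Longrightarrow> e ! i \<le> i"
    and "i < j \<Longrightarrow> j < k \<Longrightarrow> k < n \<Longrightarrow> e ! j \<le> e ! i \<Longrightarrow> e ! j \<le> e ! k \<Longrightarrow> e ! i = e ! k"
  using assms by (simp_all add: ge_le_ne_avoiders_iff)

lemma finite_ge_le_ne_avoiders: "finite (ge_le_ne_avoiders n)"
proof (rule finite_subset)
  show "ge_le_ne_avoiders n \<subseteq> {e. set e \<subseteq> {..n} \<and> length e = n}"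
    by (auto simp: ge_le_ne_avoiders_iff in_set_conv_nth) (meson less_imp_le order.trans)
qed (simp add: finite_lists_length_eq)

lemma ge_le_ne_avoiders_shift:
  assumes "e \<in> ge_le_ne_avoiders n"
  shows "0 # map Suc e \<in> ge_le_ne_avoiders (Suc n)"
  unfolding ge_le_ne_avoiders_iff
proof (intro conjI allI impI)
  show "length (0 # map Suc e) = Suc n"
    using assms by (simp add: ge_le_ne_avoiders_iff)
  show "(0 # map Suc e) ! i \<le> i" if "i < Suc n" for i
    using ge_le_ne_avoidersD(1,2)[OF assms] that by (cases i) auto
next
  fix i j k
  assume *: "i < j" "j < k" "k < Suc n"
    "(0 # map Suc e) ! j \<le> (0 # map Suc e) ! i" "(0 # map Suc e) ! j \<le> (0 # map Suc e) ! k"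
  then obtain j' k' where jk: "j = Suc j'" "k = Suc k'"
    by (metis not_less_zero old.nat.exhaust)
  have len: "length e = n" using assms by (simp add: ge_le_ne_avoiders_iff)
  \<comment> \<open>The new entry 0 cannot be the first letter, since the entries after it are positive.\<close>
  then obtain i' where i: "i = Suc i'"
    using * jk by (cases i) auto
  have "i' < j'" "j' < k'" "k' < n" "e ! j' \<le> e ! i'" "e ! j' \<le> e ! k'"
    using * i jk len by auto
  then have "e ! i' = e ! k'"
    using ge_le_ne_avoidersD(3)[OF assms] by blast
  then show "(0 # map Suc e) ! i = (0 # map Suc e) ! k"
    using * i jk len by simp
qed

text \<open>
  A final 0 that ends a forbidden triple forces the middle letter to be 0, hence to be the first entry,
  which leaves no position for the first letter.
\<close>

lemma ge_le_ne_avoiders_snoc_0: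
  assumes "e \<in> ge_le_ne_avoiders n" and "\<And>i. 0 < i \<Longrightarrow> i < n \<Longrightarrow> 0 < e ! i"
  shows "e @ [0] \<in> ge_le_ne_avoiders (Suc n)"
  using assms by (auto simp: ge_le_ne_avoiders_iff nth_append less_Suc_eq)
    (metis gr_zeroI less_zeroE)

text \<open>
  The window of \<open>m\<close> entries after the first one: \<open>m = n - 1\<close> undoes the shift, and \<open>m = n - 2\<close> also
  removes a final zero. Lowering by one keeps the order of the entries only because they are
  positive; with truncated subtraction, a zero would become equal to an entry 1.
\<close>

lemma ge_le_ne_avoiders_unshift:
  assumes e: "e \<in> ge_le_ne_avoiders n" and "Suc m \<le> n"
    and pos: "\<And>i. i < m \<Longrightarrow> 0 < e ! Suc i"
  shows "map (\<lambda>i. e ! Suc i - 1) [0..<m] \<in> ge_le_ne_avoiders m"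
  unfolding ge_le_ne_avoiders_iff
proof (intro conjI allI impI)
  show "map (\<lambda>i. e ! Suc i - 1) [0..<m] ! i \<le> i" if "i < m" for i
    using ge_le_ne_avoidersD(2)[OF e, of "Suc i"] that assms(2) by simp
next
  fix i j k
  assume "i < j" "j < k" "k < m"
    "map (\<lambda>i. e ! Suc i - 1) [0..<m] ! j \<le> map (\<lambda>i. e ! Suc i - 1) [0..<m] ! i"
    "map (\<lambda>i. e ! Suc i - 1) [0..<m] ! j \<le> map (\<lambda>i. e ! Suc i - 1) [0..<m] ! k"
  moreover from this have "0 < e ! Suc i" "0 < e ! Suc j" "0 < e ! Suc k"
    by (simp_all add: pos)
  ultimately have "Suc i < Suc j" "Suc j < Suc k" "Suc k < n"
    "e ! Suc j \<le> e ! Suc i" "e ! Suc j \<le> e ! Suc k"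
    using assms(2) by auto
  then have "e ! Suc i = e ! Suc k"
    using ge_le_ne_avoidersD(3)[OF e] by blast
  with \<open>i < j\<close> \<open>j < k\<close> \<open>k < m\<close>
  show "map (\<lambda>i. e ! Suc i - 1) [0..<m] ! i = map (\<lambda>i. e ! Suc i - 1) [0..<m] ! k"
    by simp
qed simp

text \<open>
  An inner zero would force the last entry to agree with both of the first two entries, 0 and 1.
\<close>

lemma inner_entry_pos:
  assumes e: "e \<in> ge_le_ne_avoiders (Suc n)" and "e ! 1 = 1" and "0 < j" "j < n"
  shows "0 < e ! j"
proof (rule ccontr)
  assume "\<not> 0 < e ! j"
  then have "e ! j = 0" by simp
  moreover have "j \<noteq> 1"
    using \<open>e ! j = 0\<close> \<open>e ! 1 = 1\<close> by (intro notI) simp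
  ultimately have "e ! 0 = e ! n" "e ! 1 = e ! n"
    using \<open>0 < j\<close> \<open>j < n\<close> ge_le_ne_avoidersD(3)[OF e, of 0 j n] ge_le_ne_avoidersD(3)[OF e, of 1 j n]
    by simp_all
  moreover have "e ! 0 = 0" using ge_le_ne_avoidersD(2)[OF e, of 0] by simp
  ultimately show False using \<open>e ! 1 = 1\<close> by simp
qed

lemma ge_le_ne_avoiders_Suc_Suc:
  "ge_le_ne_avoiders (Suc (Suc n)) = insert (replicate (Suc (Suc n)) 0)
     ((\<lambda>e. 0 # map Suc e) ` ge_le_ne_avoiders (Suc n) \<union> (\<lambda>e. 0 # map Suc e @ [0]) ` ge_le_ne_avoiders n)"
proof (intro equalityI subsetI)
  fix e assume e: "e \<in> ge_le_ne_avoiders (Suc (Suc n))"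
  then have len: "length e = Suc (Suc n)" and bound: "\<And>i. i < Suc (Suc n) \<Longrightarrow> e ! i \<le> i"
    and av: "\<And>i j k. i < j \<Longrightarrow> j < k \<Longrightarrow> k < Suc (Suc n) \<Longrightarrow> e ! j \<le> e ! i \<Longrightarrow> e ! j \<le> e ! k
               \<Longrightarrow> e ! i = e ! k"
    using ge_le_ne_avoidersD[OF e] by blast+
  have e0: "e ! 0 = 0" using bound[of 0] by simp
  consider "e ! 1 = 0" | "e ! 1 = 1" "e ! Suc n \<noteq> 0" | "e ! 1 = 1" "e ! Suc n = 0"
    using bound[of 1] by (cases "e ! 1 = 0") auto
  then show "e \<in> insert (replicate (Suc (Suc n)) 0)
     ((\<lambda>e. 0 # map Suc e) ` ge_le_ne_avoiders (Suc n) \<union> (\<lambda>e. 0 # map Suc e @ [0]) ` ge_le_ne_avoiders n)"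
  proof cases
    case 1
    have "e ! i = 0" if "i < Suc (Suc n)" for i
      using that av[of 0 1 i] e0 1 by (cases "i = 0 \<or> i = 1") auto
    then have "e = replicate (Suc (Suc n)) 0"
      using len by (intro nth_equalityI) (auto simp del: replicate_Suc)
    then show ?thesis by simp
  next
    case 2
    have pos: "0 < e ! Suc i" if "i < Suc n" for i
      using that inner_entry_pos[OF e \<open>e ! 1 = 1\<close>, of "Suc i"] 2 by (cases "i = n") auto
    define d where "d = map (\<lambda>i. e ! Suc i - 1) [0..<Suc n]"
    have "d \<in> ge_le_ne_avoiders (Suc n)"
      unfolding d_def by (rule ge_le_ne_avoiders_unshift[OF e]) (auto intro: pos)
    moreover have "e = 0 # map Suc d"
    proof (rule nth_equalityI)
      show "e ! i = (0 # map Suc d) ! i" if "i < length e" for i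
        using that len pos e0 by (cases i) (simp_all add: d_def del: upt_Suc)
    qed (simp add: len d_def)
    ultimately show ?thesis by blast
  next
    case 3
    have pos: "0 < e ! Suc i" if "i < n" for i
      using that inner_entry_pos[OF e \<open>e ! 1 = 1\<close>, of "Suc i"] by auto
    define d where "d = map (\<lambda>i. e ! Suc i - 1) [0..<n]"
    have "d \<in> ge_le_ne_avoiders n"
      unfolding d_def by (rule ge_le_ne_avoiders_unshift[OF e]) (auto intro: pos)
    moreover have "e = 0 # map Suc d @ [0]"
    proof (rule nth_equalityI)
      fix i assume "i < length e"
      then consider "i = 0" | "i = Suc n" | i' where "i = Suc i'" "i' < n"
        using len by (cases i) (auto simp: less_Suc_eq)
      then show "e ! i = (0 # map Suc d @ [0]) ! i"
        using pos e0 3 by cases (auto simp: d_def nth_append)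
    qed (simp add: len d_def)
    ultimately show ?thesis by blast
  qed
next
  fix e assume "e \<in> insert (replicate (Suc (Suc n)) 0)
     ((\<lambda>e. 0 # map Suc e) ` ge_le_ne_avoiders (Suc n) \<union> (\<lambda>e. 0 # map Suc e @ [0]) ` ge_le_ne_avoiders n)"
  then consider "e = replicate (Suc (Suc n)) 0"
    | d where "d \<in> ge_le_ne_avoiders (Suc n)" "e = 0 # map Suc d"
    | d where "d \<in> ge_le_ne_avoiders n" "e = (0 # map Suc d) @ [0]"
    by auto
  then show "e \<in> ge_le_ne_avoiders (Suc (Suc n))"
  proof cases
    case 1
    then show ?thesis by (simp add: ge_le_ne_avoiders_iff del: replicate_Suc)
  next
    case 2
    then show ?thesis using ge_le_ne_avoiders_shift by blast
  next
    case 3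
    then have "length d = n" by (simp add: ge_le_ne_avoiders_iff)
    with ge_le_ne_avoiders_shift[OF 3(1)] show ?thesis
      unfolding 3(2) by (intro ge_le_ne_avoiders_snoc_0) (auto simp: nth_Cons')
  qed
qed

lemma card_ge_le_ne_avoiders: "card (ge_le_ne_avoiders (Suc n)) = fib (n + 3) - 1"
  \<comment> \<open>The recurrence starts one step late: for length 2, removing both zeros of \<open>[0, 0]\<close> leaves the
      empty sequence, so the constant sequence would be counted twice.\<close>
proof (induction n rule: fib.induct)
  case 1
  have "ge_le_ne_avoiders (Suc 0) = {[0]}"
    by (auto simp: ge_le_ne_avoiders_iff length_Suc_conv)
  then show ?case by (simp add: numeral_eq_Suc)
next
  case 2
  have "ge_le_ne_avoiders 0 = {[]}" "ge_le_ne_avoiders (Suc 0) = {[0]}"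
    by (auto simp: ge_le_ne_avoiders_iff length_Suc_conv)
  then have "ge_le_ne_avoiders (Suc (Suc 0)) = {[0, 0], [0, 1]}"
    by (auto simp: ge_le_ne_avoiders_Suc_Suc)
  then show ?case by (simp add: numeral_eq_Suc)
next
  case (3 n)
  let ?Z = "replicate (Suc (Suc (Suc n))) (0 :: nat)"
  let ?A = "(\<lambda>e. 0 # map Suc e) ` ge_le_ne_avoiders (Suc (Suc n))"
  let ?B = "(\<lambda>e. 0 # map Suc e @ [0]) ` ge_le_ne_avoiders (Suc n)"
  have "?Z \<notin> ?A \<union> ?B"
    by (auto simp: ge_le_ne_avoiders_iff length_Suc_conv)
  \<comment> \<open>A nonempty shifted part never ends in 0.\<close>
  moreover have "?A \<inter> ?B = {}"
  proof -
    have "map Suc d \<noteq> map Suc d' @ [0]" for d d'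
      by (metis Suc_neq_Zero in_set_conv_decomp ex_map_conv)
    then show ?thesis by auto
  qed
  moreover have "card ?A = card (ge_le_ne_avoiders (Suc (Suc n)))"
    "card ?B = card (ge_le_ne_avoiders (Suc n))"
    by (auto intro!: card_image inj_onI simp: inj_map_eq_map)
  ultimately have "card (ge_le_ne_avoiders (Suc (Suc (Suc n)))) =
      Suc (card (ge_le_ne_avoiders (Suc (Suc n))) + card (ge_le_ne_avoiders (Suc n)))"
    by (simp add: ge_le_ne_avoiders_Suc_Suc[of "Suc n"] card_Un_disjoint finite_ge_le_ne_avoiders
        del: replicate_Suc)
  moreover have "fib (Suc n + 3) > 0" "fib (n + 3) > 0"
    by (simp_all add: fib_neq_0_nat del: add_Suc)
  moreover have "fib (Suc (Suc n) + 3) = fib (Suc n + 3) + fib (n + 3)"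
    by (simp add: numeral_eq_Suc)
  ultimately show ?case
    using 3 by linarith
qed

theorem theorem2p11:
  fixes n :: nat
  assumes "n \<ge> 1"
  shows "inv_seqs_avoiding n {[0, 0, 1], [1, 0, 0]} = inv_seqs_avoiding_rels n (\<ge>) (\<le>) (\<noteq>)
       \<and> card (inv_seqs_avoiding n {[0, 0, 1], [1, 0, 0]}) = fib (n + 2) - 1"
proof -
  obtain m where "n = Suc m" using assms by (cases n) auto
  then have "card (ge_le_ne_avoiders n) = fib (n + 2) - 1"
    using card_ge_le_ne_avoiders[of m] by (simp add: numeral_eq_Suc)
  then show ?thesis unfolding inv_seqs_avoiding_001_100_eq by blast
qed

end
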